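(* The two lattice paths \[ \begin{aligned} \omega_1&=RRURRURRRRRRURURUURRURRRUU,\\ \omega_2&=RRURRRURRRRRURUURURRURRRUU \end{aligned} \] belong to $\mathcal{D}(17,9)$ and satisfy \[ L(\omega_1)=L(\omega_2)\qquad\text{and}\qquad \overline{\mathcal{G}}(\omega_1)\not\cong\overline{\mathcal{G}}(\omega_2). \] Consequently, lattice paths in the same set $\mathcal{D}(a,b)$ with the same Lagrange number need not have isomorphic band graphs.
   Context: **Lattice paths.** Let $a,b$ be relatively prime positive integers with $0<b<a$. A lattice path from $(0,0)$ to $(a,b)$ is a word in the letters $R$ (rightward unit step) and $U$ (upward unit step) containing exactly $a$ letters $R$ and $b$ letters $U$. $\mathcal{D}(a,b)$ is the set of all such paths for which every lattice point $(x,y)$ visited by the path (starting at $(0,0)$) satisfies $ay\le bx$. **Coefficient word.** For $\omega=x_1\cdots x_\ell\in\mathcal{D}(a,b)$ with $x_i\in\{R,U\}$, the coefficient word $c(\omega)=c_1c_2\cdots c_n$, a word in the alphabet $\{1,2\}$, is formed as follows. First write $2$. Then, for $i=1,\dots,\ell-1$ in order, append $1,1$ if $x_ix_{i+1}\in\{RR,UU\}$, and append $2$ if $x_ix_{i+1}\in\{RU,UR\}$. (For example, $c(RRU)=2112$.) **Lagrange number.** The Lagrange number of a real number $\alpha$ is the supremum of all real $\ell$ for which there exist infinitely many rational numbers $p/q$ with $|\alpha-p/q|<1/(\ell q^2)$. For a lattice path $\omega$ with $c(\omega)=c_1\cdots c_n$, $L(\omega)$ denotes the Lagrange number of the real number given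 by the purely periodic simple continued fraction $[\overline{c_1,\dots,c_n}]=[c_1,\dots,c_n,c_1,\dots,c_n,\dots]$, where $[a_1,a_2,\dots]=a_1+\cfrac{1}{a_2+\cfrac{1}{a_3+\cdots}}$. **Band graphs.** A tile is a square planar graph with four vertices and four edges. A snake graph is a connected planar graph obtained by gluing tiles $G_1,\dots,G_d$ in order so that $G_{i+1}$ shares exactly one full edge with $G_i$: either the north edge of $G_i$ is the south edge of $G_{i+1}$, or the east edge of $G_i$ is the west edge of $G_{i+1}$. A newly added tile does not overlap any earlier nonconsecutive tile. A sign function assigns $\pm$ to each edge so that on every tile the north and west edges have equal sign, the south and east edges have equal sign, and the north and south edges have opposite signs. A band graph is obtained by choosing the south or west edge of $G_1$ and an edge of the same sign among the north and east edges of $G_d$, and identifying these two edges by their corresponding endpoints. If the lengths of the maximal constant blocks in its cyclic sign sequence are $a_1,\dots,a_n$ in order, the band graph is denoted $\mathcal{G}[\overline{a_1,\dots,a_n}]$; the cyclic sequence is considered up to cyclic shift and reversal. The band graph of a lattice path $\omega$ with $c(\omega)=c_1\cdots c_n$ is $\overline{\mathcal{G}}(\omega)=\mathcal{G}[\overline{c_1,\dots,c_n}]$. **Isomorphism of band graphs.** Define on words of length $n$ over $\{1,2\}$ the cyclic shift $T(c_1,\dots,c_n)=(c_2,\dots,c_n,c_1)$ and the reversal $R(c_1,\dots,c_n)=(c_n,\dots,c_1)$. Two words $c,d\in\{1,2\}^n$ are cyclically equivalent, $c\sim d$, if $d=T^k(c)$ or $d=T^k(R(c))$ for some integer $0\le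 k<n$. By definition, $\overline{\mathcal{G}}(\omega)\cong\overline{\mathcal{G}}(\upsilon)$ if and only if $c(\omega)\sim c(\upsilon)$. *)

theory Defs
  imports Complex_Main "HOL-Library.Extended_Real"
begin

datatype step = R | U

(* The point reached after k steps is
   (x, y) = (count_list (take k w) R, count_list (take k w) U). *)
definition lattice_paths :: "nat \<Rightarrow> nat \<Rightarrow> step list set" where
  "lattice_paths a b =
     {w. count_list w R = a \<and> count_list w U = b \<and>
         (\<forall>k\<le>length w. a * count_list (take k w) U \<le> b * count_list (take k w) R)}"

definition coeff_word :: "step list \<Rightarrow> nat list" where
  "coeff_word w =
     2 # concat (map (\<lambda>i. if w ! i = w ! Suc i then [1, 1] else [2]) [0..<length w - 1])"

lemma coeff_word_RRU: "coeff_word [R, R, U] = [2, 1, 1, 2]"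
  by (simp add: coeff_word_def upt_rec)

(* The set consists of values p/q, so that the infinitely many rationals are counted as
   numbers and not as pairs (p, q).  For l < 0 and l = 0 (where 1 / 0 = 0) the condition
   is never satisfied, so only positive l matter.  The supremum is taken in the extended
   reals, where it always exists. *)
definition lagrange_number :: "real \<Rightarrow> ereal" where
  "lagrange_number \<alpha> =
     Sup (ereal ` {l. infinite {r :: real. \<exists>p q :: int. q > 0 \<and> r = of_int p / of_int q \<and>
                                \<bar>\<alpha> - of_int p / of_int q\<bar> < 1 / (l * (of_int q)\<^sup>2)}})"

fun finite_cf :: "nat list \<Rightarrow> real" where
  "finite_cf [] = 0"
| "finite_cf [a] = real a"
| "finite_cf (a # b # as) = real a + 1 / finite_cf (b # as)"

definition infinite_cf :: "(nat \<Rightarrow> nat) \<Rightarrow> real" where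
  "infinite_cf a = lim (\<lambda>n. finite_cf (map a [0..<Suc n]))"

definition periodic_cf :: "nat list \<Rightarrow> real" where
  "periodic_cf c = infinite_cf (\<lambda>i. c ! (i mod length c))"

definition path_lagrange :: "step list \<Rightarrow> ereal" where
  "path_lagrange w = lagrange_number (periodic_cf (coeff_word w))"

(* rotate k is the k-th power of the cyclic shift (c1, ..., cn) -> (c2, ..., cn, c1). *)
definition cyc_equiv :: "nat list \<Rightarrow> nat list \<Rightarrow> bool" where
  "cyc_equiv c d \<longleftrightarrow>
     length c = length d \<and> (\<exists>k<length c. d = rotate k c \<or> d = rotate k (rev c))"

lemma cyc_equiv_iff:
  assumes "c \<noteq> []"
  shows "cyc_equiv c d \<longleftrightarrow> (\<exists>k. d = rotate k c \<or> d = rotate k (rev c))"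
proof
  assume "\<exists>k. d = rotate k c \<or> d = rotate k (rev c)"
  then obtain k where k: "d = rotate k c \<or> d = rotate k (rev c)" by blast
  then have "d = rotate (k mod length c) c \<or> d = rotate (k mod length c) (rev c)"
    using rotate_conv_mod[of k c] rotate_conv_mod[of k "rev c"] by simp
  moreover have "k mod length c < length c" using assms by simp
  moreover have "length c = length d" using k by auto
  ultimately show "cyc_equiv c d" unfolding cyc_equiv_def by blast
qed (auto simp: cyc_equiv_def)

lemma cyc_equiv_refl: "c \<noteq> [] \<Longrightarrow> cyc_equiv c c"
  by (metis cyc_equiv_iff rotate0 id_apply)

lemma cyc_equiv_trans:
  assumes "c \<noteq> []" "cyc_equiv c d" "cyc_equiv d e"
  shows "cyc_equiv c e"
proof -
  have d: "d \<noteq> []" using assms by (auto simp: cyc_equiv_def)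
  have rr: "\<exists>j. rev (rotate k xs) = rotate j (rev xs)" for k and xs :: "nat list"
  proof -
    have "rotate k xs = rev (rotate (length xs - k mod length xs) (rev xs))"
      using rotate_rev[of k "rev xs"]
      by (metis length_rev rev_rev_ident)
    then show ?thesis by (metis rev_rev_ident)
  qed
  obtain k where k: "d = rotate k c \<or> d = rotate k (rev c)"
    using assms cyc_equiv_iff by blast
  obtain j where j: "e = rotate j d \<or> e = rotate j (rev d)"
    using assms d cyc_equiv_iff by blast
  have "rev d = rev (rotate k c) \<or> rev d = rev (rotate k (rev c))" using k by auto
  then obtain i where i: "rev d = rotate i (rev c) \<or> rev d = rotate i c"
    using rr[of k c] rr[of k "rev c"] by auto
  show ?thesis
    unfolding cyc_equiv_iff[OF assms(1)] using i j k by (metis rotate_rotate)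
qed

datatype tile_edge = North | East | South | West

(* A band graph with tiles G_0, ..., G_(d-1): for i < d - 1, the edge (exits ! i) of G_i is
   glued to the edge (across (exits ! i)) of G_(i+1); the last entry of exits is the edge of
   G_(d-1) that is identified with the edge initial of G_0.  Steps to the north and to the
   east never lead back to an earlier tile, so tiles never overlap. *)
datatype band_graph = Band_Graph (initial: tile_edge) (exits: "tile_edge list")

fun across :: "tile_edge \<Rightarrow> tile_edge" where
  "across North = South"
| "across East = West"
| "across South = North"
| "across West = East"

definition sign_function :: "band_graph \<Rightarrow> (nat \<Rightarrow> tile_edge \<Rightarrow> bool) \<Rightarrow> bool" where
  "sign_function B f \<longleftrightarrow>
     (\<forall>i<length (exits B).
        f i North = f i West \<and> f i South = f i East \<and> f i North \<noteq> f i South) \<and>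
     (\<forall>i. Suc i < length (exits B) \<longrightarrow>
        f i (exits B ! i) = f (Suc i) (across (exits B ! i)))"

definition signs :: "band_graph \<Rightarrow> (nat \<Rightarrow> tile_edge \<Rightarrow> bool) \<Rightarrow> bool list" where
  "signs B f = map (\<lambda>i. f i (exits B ! i)) [0..<length (exits B)]"

definition band_sign_function :: "band_graph \<Rightarrow> (nat \<Rightarrow> tile_edge \<Rightarrow> bool) \<Rightarrow> bool" where
  "band_sign_function B f \<longleftrightarrow>
     exits B \<noteq> [] \<and> set (exits B) \<subseteq> {North, East} \<and> initial B \<in> {South, West} \<and>
     sign_function B f \<and> f 0 (initial B) = last (signs B f)"

fun alternating_blocks :: "bool \<Rightarrow> nat list \<Rightarrow> bool list" where
  "alternating_blocks s [] = []"
| "alternating_blocks s (a # as) = replicate a s @ alternating_blocks (\<not> s) as"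

(* Consecutive blocks, including the last and the first one, carry opposite signs; hence
   their number is even unless the whole cyclic sequence is constant. *)
definition cyclic_blocks :: "bool list \<Rightarrow> nat list \<Rightarrow> bool" where
  "cyclic_blocks ss a \<longleftrightarrow>
     0 \<notin> set a \<and> (length a = 1 \<or> even (length a) \<and> a \<noteq> []) \<and>
     (\<exists>k s. rotate k ss = alternating_blocks s a)"

(* B is a band graph of the form G[a1, ..., an]. *)
definition has_blocks :: "band_graph \<Rightarrow> nat list \<Rightarrow> bool" where
  "has_blocks B a \<longleftrightarrow> (\<exists>f. band_sign_function B f \<and> cyclic_blocks (signs B f) a)"

definition band_iso :: "band_graph \<Rightarrow> band_graph \<Rightarrow> bool" (infix \<open>\<cong>\<^sub>B\<close> 50) where
  "B \<cong>\<^sub>B B' \<longleftrightarrow> (\<exists>c d. has_blocks B c \<and> has_blocks B' d \<and> cyc_equiv c d)"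

(* A representative of G[a1, ..., an].  Signs of edges of the same kind alternate from tile
   to tile, and the north and west edges of G_0 are given the sign True. *)
definition band_graph_of_blocks :: "nat list \<Rightarrow> band_graph" where
  "band_graph_of_blocks a =
     (let ss = alternating_blocks True a
      in Band_Graph (if last ss then West else South)
           (map (\<lambda>i. if ss ! i = even i then North else East) [0..<length ss]))"

definition path_band_graph :: "step list \<Rightarrow> band_graph" where
  "path_band_graph w = band_graph_of_blocks (coeff_word w)"

lemma length_alternating_blocks: "length (alternating_blocks s a) = sum_list a"
  by (induction a arbitrary: s) auto

lemma has_blocks_band_graph_of_blocks:
  assumes "0 \<notin> set a" "even (length a)" "a \<noteq> []"
  shows "has_blocks (band_graph_of_blocks a) a"
proof -
  define ss where "ss = alternating_blocks True a"
  define B where "B = band_graph_of_blocks a"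
  define f where "f i e = (if e = North \<or> e = West then even i else odd i)" for i :: nat and e
  have B: "initial B = (if last ss then West else South)"
    "exits B = map (\<lambda>i. if ss ! i = even i then North else East) [0..<length ss]"
    by (simp_all add: B_def band_graph_of_blocks_def ss_def Let_def)
  have "ss \<noteq> []" using assms by (cases a) (auto simp: ss_def)
  have signs: "signs B f = ss"
    by (rule nth_equalityI) (auto simp: signs_def B f_def)
  have "sign_function B f"
    by (auto simp: sign_function_def B f_def)
  then have "band_sign_function B f"
    using \<open>ss \<noteq> []\<close> by (auto simp: band_sign_function_def signs B f_def)
  moreover have "cyclic_blocks ss a"
    unfolding cyclic_blocks_def using assms by (metis ss_def rotate0 id_apply)
  ultimately show ?thesis using signs by (auto simp: has_blocks_def B_def)
qed

lemma alternating_blocks_append: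
  "alternating_blocks s (a @ b) =
     alternating_blocks s a @ alternating_blocks (s = even (length a)) b"
proof (induction a arbitrary: s)
  case (Cons x a)
  have "((\<not> s) = even (length a)) = (s = even (length (x # a)))" by auto
  then show ?case using Cons by simp
qed simp

lemma alternating_blocks_inj:
  assumes "alternating_blocks s a = alternating_blocks t b" "0 \<notin> set a" "0 \<notin> set b"
  shows "a = b"
  using assms
proof (induction a arbitrary: b s t)
  case Nil
  then show ?case by (cases b) auto
next
  case (Cons x a)
  then obtain y b' where b: "b = y # b'" by (cases b) auto
  have st: "s = t" using Cons.prems b by (cases x; cases y) auto
  have ne: "v = (\<not> u)" if "alternating_blocks (\<not> u) l = v # r" "0 \<notin> set l" for u v l r
    using that by (cases l; cases "hd l") auto
  have *: "False" if eq: "replicate m u @ alternating_blocks (\<not> u) l =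
      replicate n u @ alternating_blocks (\<not> u) l'" and l: "0 \<notin> set l" and lt: "m < n"
    for m n u l l'
  proof -
    obtain k where "n = m + Suc k" using lt less_imp_Suc_add by auto
    then have "alternating_blocks (\<not> u) l =
        u # replicate k u @ alternating_blocks (\<not> u) l'"
      using eq by (simp only: replicate_add append_assoc same_append_eq) simp
    from ne[OF this l] show False by simp
  qed
  have eq: "replicate x s @ alternating_blocks (\<not> s) a =
      replicate y s @ alternating_blocks (\<not> s) b'"
    using Cons.prems b st by simp
  have "\<not> x < y" using *[OF eq] Cons.prems by auto
  moreover have "\<not> y < x" using *[OF eq[symmetric]] Cons.prems b by auto
  ultimately have "x = y" by simp
  with eq have "alternating_blocks (\<not> s) a = alternating_blocks (\<not> s) b'" by simp
  then have "a = b'" using Cons.IH Cons.prems b by auto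
  then show ?case using b \<open>x = y\<close> by simp
qed

lemma hd_last_alternating_blocks:
  assumes "0 \<notin> set a" "a \<noteq> []"
  shows "alternating_blocks s a \<noteq> []" "hd (alternating_blocks s a) = s"
    "last (alternating_blocks s a) = (s = odd (length a))"
proof -
  obtain x b where "a = x # b" "x \<noteq> 0" using assms by (cases a) auto
  then show "alternating_blocks s a \<noteq> []" "hd (alternating_blocks s a) = s"
    by (cases x; simp)+
  obtain y c where "a = c @ [y]" "y \<noteq> 0"
    using assms by (cases a rule: rev_cases) auto
  then show "last (alternating_blocks s a) = (s = odd (length a))"
    by (cases y) (auto simp: alternating_blocks_append last_append)
qed

lemma rotate_alternating_blocks:
  assumes "k < sum_list a" "0 \<notin> set a" "even (length a)"
  shows "\<exists>a1 m a2 r. a = a1 @ m # a2 \<and> r < m \<and>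
     rotate k (alternating_blocks s a) =
       replicate (m - r) (s = even (length a1)) @
       alternating_blocks (s = odd (length a1)) (a2 @ a1) @
       replicate r (s = even (length a1))"
proof -
  have "\<exists>a1 m a2 r. a = a1 @ m # a2 \<and> r < m \<and> k = sum_list a1 + r"
    using assms(1)
  proof (induction a arbitrary: k)
    case (Cons x a)
    show ?case
    proof (cases "k < x")
      case True
      then have "x # a = [] @ x # a \<and> k < x \<and> k = sum_list [] + k" by simp
      then show ?thesis by blast
    next
      case False
      then have "k - x < sum_list a" using Cons.prems by simp
      then obtain a1 m a2 r where "a = a1 @ m # a2" "r < m" "k - x = sum_list a1 + r"
        using Cons.IH by blast
      then have "x # a = (x # a1) @ m # a2 \<and> r < m \<and> k = sum_list (x # a1) + r"
        using False by simp
      then show ?thesis by blast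
    qed
  qed simp
  then obtain a1 m a2 r where a: "a = a1 @ m # a2" "r < m" "k = sum_list a1 + r" by blast
  define t where "t = (s = even (length a1))"
  let ?u = "alternating_blocks s a1 @ replicate r t"
  let ?v = "replicate (m - r) t @ alternating_blocks (\<not> t) a2"
  have "replicate m t = replicate r t @ replicate (m - r) t"
    using a(2) by (metis le_add_diff_inverse less_imp_le replicate_add)
  then have split: "alternating_blocks s a = ?u @ ?v"
    by (simp add: a alternating_blocks_append t_def)
  have "length ?u = k" by (simp add: a length_alternating_blocks)
  then have "rotate k (alternating_blocks s a) = ?v @ ?u"
    using split rotate_append[of ?u ?v] by simp
  moreover have "((\<not> t) = even (length a2)) = s"
    using assms(3) by (auto simp: a t_def)
  moreover have "(\<not> t) = (s = odd (length a1))" by (auto simp: t_def)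
  ultimately show ?thesis
    using a by (intro exI[of _ a1] exI[of _ m] exI[of _ a2] exI[of _ r])
      (simp add: alternating_blocks_append t_def)
qed

lemma rotate_back: "\<exists>j. rotate j (rotate k xs) = xs"
proof -
  have "rotate (length xs - k mod length xs + k mod length xs) xs = xs" if "xs \<noteq> []"
    using that by (simp add: less_imp_le)
  then show ?thesis by (metis rotate_conv_mod rotate_rotate rotate_is_Nil_conv)
qed

lemma cyclic_blocks_unique:
  assumes a: "cyclic_blocks ss a" "even (length a)" and b: "cyclic_blocks ss b"
  shows "\<exists>k. b = rotate k a"
proof -
  obtain k s where k: "rotate k ss = alternating_blocks s a"
    using a by (auto simp: cyclic_blocks_def)
  obtain l t where l: "rotate l ss = alternating_blocks t b"
    using b by (auto simp: cyclic_blocks_def)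
  have a': "0 \<notin> set a" "a \<noteq> []" and b': "0 \<notin> set b" "b \<noteq> []"
    "length b = 1 \<or> even (length b)"
    using a b by (auto simp: cyclic_blocks_def)
  obtain i where "rotate i (rotate k ss) = ss" using rotate_back by blast
  then have rot: "rotate (l + i) (alternating_blocks s a) = alternating_blocks t b"
    using k l by (metis rotate_rotate)
  define j where "j = (l + i) mod sum_list a"
  have "sum_list a \<noteq> 0" using a' by (cases a) auto
  then have "j < sum_list a" unfolding j_def by (metis mod_less_divisor gr0I)
  moreover have rotj: "rotate j (alternating_blocks s a) = alternating_blocks t b"
    unfolding j_def by (metis rot rotate_conv_mod length_alternating_blocks)
  ultimately obtain a1 m a2 r where m: "a = a1 @ m # a2" "r < m"
    and eq: "alternating_blocks t b = replicate (m - r) (s = even (length a1)) @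
       alternating_blocks (s = odd (length a1)) (a2 @ a1) @
       replicate r (s = even (length a1))"
    using rotate_alternating_blocks[OF _ a'(1) a(2)] by metis
  have "even (length b)"
  proof (rule ccontr)
    assume "odd (length b)"
    then obtain n where "b = [n]" using b'(3) by (cases b) auto
    then have "set (alternating_blocks t b) \<subseteq> {t}" by auto
    then have "set (alternating_blocks s a) \<subseteq> {t}" by (metis rotj set_rotate)
    moreover have "hd (alternating_blocks s a) \<noteq> last (alternating_blocks s a)"
      using hd_last_alternating_blocks[OF a', of s] a(2) by simp
    ultimately show False
      using hd_last_alternating_blocks(1)[OF a', of s]
      by (metis hd_in_set last_in_set singletonD subsetD)
  qed
  then have hl: "hd (alternating_blocks t b) \<noteq> last (alternating_blocks t b)"
    using hd_last_alternating_blocks[OF b'(1,2), of t] by simp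
  have "r = 0"
  proof (rule ccontr)
    assume "r \<noteq> 0"
    then have "hd (alternating_blocks t b) = last (alternating_blocks t b)"
      unfolding eq using m(2) by (simp add: hd_append last_append)
    then show False using hl by simp
  qed
  then have "alternating_blocks t b = alternating_blocks (s = even (length a1)) (m # a2 @ a1)"
    using eq by auto
  then have "b = m # a2 @ a1"
    by (rule alternating_blocks_inj) (use a'(1) b'(1) m(1) in auto)
  also have "\<dots> = rotate (length a1) a"
    using rotate_append[of a1 "m # a2"] m(1) by simp
  finally show ?thesis by blast
qed

lemma sign_function_unique:
  assumes f: "sign_function B f" and g: "sign_function B g"
    and ex: "set (exits B) \<subseteq> {North, East}"
  shows "signs B g = signs B f \<or> signs B g = map Not (signs B f)"
proof -
  have step: "(g i e = f i e) = (g i North = f i North)" if "i < length (exits B)" for i e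
    using f g that by (cases e) (auto simp: sign_function_def)
  have north: "(g i North = f i North) = (g 0 North = f 0 North)"
    if "i < length (exits B)" for i
    using that
  proof (induction i)
    case (Suc i)
    let ?e = "exits B ! i"
    have "(g i ?e = f i ?e) = (g (Suc i) (across ?e) = f (Suc i) (across ?e))"
      using f g Suc.prems by (simp add: sign_function_def)
    then show ?case using step[of i ?e] step[of "Suc i" "across ?e"] Suc by simp
  qed simp
  have edge: "(g i e = f i e) = (g 0 North = f 0 North)" if "i < length (exits B)" for i e
    using step[OF that] north[OF that] by simp
  show ?thesis
  proof (cases "g 0 North = f 0 North")
    case True
    then have "signs B g = signs B f"
      unfolding signs_def using edge by (intro map_cong refl) simp
    then show ?thesis ..
  next
    case False
    then have "g i e = (\<not> f i e)" if "i < length (exits B)" for i e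
      using edge[OF that, of e] by blast
    then have "signs B g = map Not (signs B f)"
      unfolding signs_def map_map comp_def by (intro map_cong refl) simp
    then show ?thesis ..
  qed
qed

lemma map_Not_alternating_blocks:
  "map Not (alternating_blocks s a) = alternating_blocks (\<not> s) a"
  by (induction a arbitrary: s) auto

lemma has_blocks_unique:
  assumes "has_blocks B a" "even (length a)" "has_blocks B b"
  shows "\<exists>k. b = rotate k a"
proof -
  obtain f g where f: "band_sign_function B f" "cyclic_blocks (signs B f) a"
    and g: "band_sign_function B g" "cyclic_blocks (signs B g) b"
    using assms by (auto simp: has_blocks_def)
  have "signs B g = signs B f \<or> signs B g = map Not (signs B f)"
    using f g sign_function_unique by (auto simp: band_sign_function_def)
  then have "cyclic_blocks (signs B g) a"
  proof
    assume "signs B g = map Not (signs B f)"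
    then show ?thesis
      using f(2) unfolding cyclic_blocks_def by (metis rotate_map map_Not_alternating_blocks)
  qed (use f in simp)
  then show ?thesis using cyclic_blocks_unique assms g by blast
qed

theorem band_iso_iff_cyc_equiv:
  assumes "0 \<notin> set a" "even (length a)" "a \<noteq> []"
    and "0 \<notin> set b" "even (length b)" "b \<noteq> []"
  shows "band_graph_of_blocks a \<cong>\<^sub>B band_graph_of_blocks b \<longleftrightarrow> cyc_equiv a b"
proof
  assume "cyc_equiv a b"
  then show "band_graph_of_blocks a \<cong>\<^sub>B band_graph_of_blocks b"
    unfolding band_iso_def using assms has_blocks_band_graph_of_blocks by blast
next
  assume "band_graph_of_blocks a \<cong>\<^sub>B band_graph_of_blocks b"
  then obtain c d where c: "has_blocks (band_graph_of_blocks a) c"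
    and d: "has_blocks (band_graph_of_blocks b) d" and cd: "cyc_equiv c d"
    by (auto simp: band_iso_def)
  obtain k where k: "c = rotate k a"
    using has_blocks_unique[OF has_blocks_band_graph_of_blocks] c assms by blast
  obtain l where l: "d = rotate l b"
    using has_blocks_unique[OF has_blocks_band_graph_of_blocks] d assms by blast
  have "cyc_equiv a c" using k assms(3) cyc_equiv_iff by blast
  moreover have "cyc_equiv d b"
    using l rotate_back[of l b] assms(6) cyc_equiv_iff[of d b] by (metis rotate_is_Nil_conv)
  ultimately show "cyc_equiv a b" using cd cyc_equiv_trans assms(3)
    by (metis k rotate_is_Nil_conv)
qed

lemma length_coeff_word_parity:
  "w \<noteq> [] \<Longrightarrow> even (length (coeff_word w)) \<longleftrightarrow> hd w \<noteq> last w"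
proof (induction w rule: rev_nonempty_induct)
  case (snoc x w)
  have "map (\<lambda>i. if (w @ [x]) ! i = (w @ [x]) ! Suc i then [1, 1] else [2 :: nat]) [0..<length w - 1]
      = map (\<lambda>i. if w ! i = w ! Suc i then [1, 1] else [2]) [0..<length w - 1]"
    by (intro map_cong) (auto simp: nth_append)
  then have "concat (map (\<lambda>i. if (w @ [x]) ! i = (w @ [x]) ! Suc i then [1, 1] else [2 :: nat]) [0..<length w - 1])
      = concat (map (\<lambda>i. if w ! i = w ! Suc i then [1, 1] else [2]) [0..<length w - 1])"
    by (rule arg_cong)
  moreover have "[0..<length w] = [0..<length w - 1] @ [length w - 1]"
    using snoc.hyps by (cases w) auto
  ultimately have "coeff_word (w @ [x]) =
      coeff_word w @ (if last w = x then [1, 1] else [2])"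
    using snoc.hyps by (simp add: coeff_word_def last_conv_nth del: One_nat_def) (simp add: nth_append)
  moreover have "hd w = last w \<or> hd w = x \<or> last w = x"
    by (cases "hd w"; cases "last w"; cases x) auto
  ultimately show ?case using snoc by auto
qed (simp add: coeff_word_def)

lemma even_length_coeff_word:
  assumes "w \<in> lattice_paths a b" "0 < b" "b < a"
  shows "even (length (coeff_word w))"
proof -
  have cnt: "count_list w R = a" "count_list w U = b"
    and le: "\<And>k. k \<le> length w \<Longrightarrow> a * count_list (take k w) U \<le> b * count_list (take k w) R"
    using assms(1) by (auto simp: lattice_paths_def)
  have "w \<noteq> []" using cnt assms(2) by auto
  have "hd w = R"
  proof (cases w)
    case (Cons x v)
    then show ?thesis using le[of 1] assms by (cases x) auto
  qed (use \<open>w \<noteq> []\<close> in simp)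
  moreover have "last w = U"
  proof (rule ccontr)
    assume "last w \<noteq> U"
    then have "last w = R" by (cases "last w") auto
    then have w: "w = butlast w @ [R]" using \<open>w \<noteq> []\<close> by (metis append_butlast_last_id)
    have "count_list w R = Suc (count_list (butlast w) R)"
      "count_list w U = count_list (butlast w) U"
      by (subst w, simp)+
    then have "a * b \<le> b * (a - 1)"
      using le[of "length w - 1"] cnt by (simp add: butlast_conv_take)
    then show False using assms by (cases a) auto
  qed
  ultimately show ?thesis using length_coeff_word_parity[OF \<open>w \<noteq> []\<close>] by simp
qed

theorem path_band_graph_iso_iff:
  assumes "w \<in> lattice_paths a b" "v \<in> lattice_paths a b" "0 < b" "b < a"
  shows "path_band_graph w \<cong>\<^sub>B path_band_graph v \<longleftrightarrow> cyc_equiv (coeff_word w) (coeff_word v)"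
proof -
  have "0 \<notin> set (coeff_word u) \<and> coeff_word u \<noteq> []" for u
    by (auto simp: coeff_word_def split: if_splits)
  then show ?thesis
    unfolding path_band_graph_def
    using assms by (intro band_iso_iff_cyc_equiv) (auto intro: even_length_coeff_word)
qed

definition \<omega>\<^sub>1 :: "step list" where
  "\<omega>\<^sub>1 = [R,R,U,R,R,U,R,R,R,R,R,R,U,R,U,R,U,U,R,R,U,R,R,R,U,U]"

definition \<omega>\<^sub>2 :: "step list" where
  "\<omega>\<^sub>2 = [R,R,U,R,R,R,U,R,R,R,R,R,U,R,U,U,R,U,R,R,U,R,R,R,U,U]"

end

theory Submission
  imports Defs "HOL-Analysis.Elementary_Normed_Spaces"
begin

text \<open>The matrix \<open>((p, q), (r, s))\<close> of one period of an even purely periodic continued fraction fixes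
  its value \<open>\<alpha>\<close> and leaves the quadratic form \<open>f = r x\<^sup>2 + (s - p) x y - q y\<^sup>2\<close> of discriminant
  \<open>D = (p + s)\<^sup>2 - 4\<close> invariant. Since \<open>y\<^sup>2 \<bar>\<alpha> - x / y\<bar>\<close> tends to \<open>\<bar>f(x, y)\<bar> / \<surd>D\<close> for the
  approximations \<open>x / y\<close> of \<open>\<alpha>\<close>, the Lagrange number of \<open>\<alpha>\<close> is \<open>\<surd>D / m\<close>, where \<open>m\<close> is the minimum
  of \<open>\<bar>f\<bar>\<close> on the positive quadrant: powers of the matrix carry one minimal vector to infinitely many.
  The minimum is found along Conway's river, which is periodic. For both paths the trace
  \<open>p + s\<close> is 19974212955 and \<open>m\<close> is 6252914545, although the coefficient words are
  not cyclically equivalent.\<close>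

section \<open>Values of indefinite binary quadratic forms\<close>

fun form :: "int \<times> int \<times> int \<Rightarrow> int \<Rightarrow> int \<Rightarrow> int" where
  "form (a, h, c) x y = a * x\<^sup>2 + h * x * y - c * y\<^sup>2"

text \<open>A form with \<open>a, c > 0\<close> takes values of opposite sign at \<open>(1, 0)\<close> and \<open>(0, 1)\<close>. One step replaces
  one of the two vectors by their sum so that the signs remain opposite; the quadrant left behind
  carries values of one sign only, and these grow away from its boundary.\<close>
fun river_step :: "int \<times> int \<times> int \<Rightarrow> int \<times> int \<times> int" where
  "river_step (a, h, c) =
     (if a + h - c > 0 then (a + h - c, h - 2 * c, c) else (a, h + 2 * a, c - a - h))"

fun outer_ge :: "int \<Rightarrow> int \<times> int \<times> int \<Rightarrow> bool" where
  "outer_ge m (a, h, c) \<longleftrightarrow> m \<le> a \<and> m \<le> c"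

lemma mult_square_ge:
  fixes m a x :: int
  assumes "m \<le> a" "0 < m" "x \<noteq> 0"
  shows "m \<le> a * x\<^sup>2"
proof -
  have "0 < x\<^sup>2" using assms(3) by simp
  then have "1 \<le> x\<^sup>2" by linarith
  then have "a * 1 \<le> a * x\<^sup>2" using assms by (intro mult_left_mono) auto
  then show ?thesis using assms(1) by simp
qed

text \<open>Induction on \<open>x + y\<close> along the river. If the vector lies in the quadrant of
  the next pair of basis vectors, its coordinates there have a smaller sum. Otherwise it lies in the
  quadrant left behind, where in the adapted basis all terms of the form have the same sign and one
  of them alone is at least \<open>m\<close> in absolute value.\<close>

lemma abs_form_ge:
  assumes "\<And>n. outer_ge m ((river_step ^^ n) (a, h, c))" "0 < m"
    and "0 \<le> x" "0 \<le> y" "x \<noteq> 0 \<or> y \<noteq> 0"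
  shows "m \<le> \<bar>form (a, h, c) x y\<bar>"
  using assms
proof (induction "nat (x + y)" arbitrary: a h c x y rule: less_induct)
  case less
  have ac: "m \<le> a" "m \<le> c" using less.prems(1)[of 0] by auto
  have next_ge: "outer_ge m ((river_step ^^ n) (river_step (a, h, c)))" for n
    using less.prems(1)[of "Suc n"] by (simp only: funpow_Suc_right comp_apply)
  show ?case
  proof (cases "x = 0 \<or> y = 0")
    case True
    then show ?thesis
      using mult_square_ge[OF ac(1) \<open>0 < m\<close>, of x] mult_square_ge[OF ac(2) \<open>0 < m\<close>, of y] less.prems
      by auto
  next
    case False
    then have pos: "0 < x" "0 < y" using less.prems by auto
    show ?thesis
    proof (cases "a + h - c > 0")
      case True
      then have nx: "river_step (a, h, c) = (a + h - c, h - 2 * c, c)" by simp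
      then have t: "m \<le> a + h - c" using next_ge[of 0] by simp
      show ?thesis
      proof (cases "x \<le> y")
        case True
        have "m \<le> \<bar>form (a + h - c, h - 2 * c, c) x (y - x)\<bar>"
          by (rule less.hyps) (use pos True next_ge nx less.prems in auto)
        also have "form (a + h - c, h - 2 * c, c) x (y - x) = form (a, h, c) x y"
          by (simp add: power2_eq_square algebra_simps)
        finally show ?thesis .
      next
        case False
        \<comment> \<open>The vector is \<open>x - y\<close> times (1, 0) plus \<open>y\<close>
          times (1, 1). In this basis the mixed coefficient is \<open>h + 2 * a\<close>, the sum of
          the positive numbers \<open>a + h - c\<close>, \<open>a\<close> and
          \<open>c\<close>.\<close>
        have "m \<le> (a + h - c) * y\<^sup>2" using mult_square_ge[OF t \<open>0 < m\<close>] pos by simp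
        moreover have "0 \<le> a * (x - y)\<^sup>2" "0 \<le> (h + 2 * a) * ((x - y) * y)"
          using False pos ac t \<open>0 < m\<close> by auto
        moreover have "form (a, h, c) x y =
            a * (x - y)\<^sup>2 + (h + 2 * a) * ((x - y) * y) + (a + h - c) * y\<^sup>2"
          by (simp add: power2_eq_square algebra_simps)
        ultimately show ?thesis by linarith
      qed
    next
      case False
      then have nx: "river_step (a, h, c) = (a, h + 2 * a, c - a - h)" by simp
      then have t: "m \<le> c - a - h" using next_ge[of 0] by simp
      show ?thesis
      proof (cases "y \<le> x")
        case True
        have "m \<le> \<bar>form (a, h + 2 * a, c - a - h) (x - y) y\<bar>"
          by (rule less.hyps) (use pos True next_ge nx less.prems in auto)
        also have "form (a, h + 2 * a, c - a - h) (x - y) y = form (a, h, c) x y"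
          by (simp add: power2_eq_square algebra_simps)
        finally show ?thesis .
      next
        case False
        have "m \<le> (c - a - h) * x\<^sup>2" using mult_square_ge[OF t \<open>0 < m\<close>] pos by simp
        moreover have "0 \<le> c * (y - x)\<^sup>2" "0 \<le> (2 * c - h) * ((y - x) * x)"
          using False pos ac t \<open>0 < m\<close> by auto
        moreover have "- form (a, h, c) x y =
            c * (y - x)\<^sup>2 + (2 * c - h) * ((y - x) * x) + (c - a - h) * x\<^sup>2"
          by (simp add: power2_eq_square algebra_simps)
        ultimately show ?thesis by linarith
      qed
    qed
  qed
qed

text \<open>A recursion in which simplification computes each iterate once from its predecessor;
  with \<open>t = s\<close> it certifies a cycle.\<close>

fun iterates_all :: "('a \<Rightarrow> bool) \<Rightarrow> ('a \<Rightarrow> 'a) \<Rightarrow> nat \<Rightarrow> 'a \<Rightarrow> 'a \<Rightarrow> bool" where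
  "iterates_all P f 0 t s \<longleftrightarrow> s = t"
| "iterates_all P f (Suc n) t s \<longleftrightarrow> P s \<and> iterates_all P f n t (f s)"

lemma iterates_all_iff:
  "iterates_all P f N t s \<longleftrightarrow> (f ^^ N) s = t \<and> (\<forall>n<N. P ((f ^^ n) s))"
  by (induction N arbitrary: s)
    (auto simp: All_less_Suc2 funpow_Suc_right simp del: funpow.simps(2))

text \<open>Reduces the condition on all river forms in \<open>abs_form_ge\<close> to a check over
  one period.\<close>

lemma iterates_all_cycle:
  assumes "iterates_all P f N s s" "0 < N"
  shows "P ((f ^^ n) s)"
  using funpow_mod_eq[of N f s n] assms unfolding iterates_all_iff by (metis mod_less_divisor)

section \<open>The Lagrange number of a quadratic irrational\<close>

lemma finite_rationals_bounded_denominator: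
  "finite {r :: real. \<exists>p q :: int. 0 < q \<and> q \<le> N \<and> r = of_int p / of_int q \<and> \<bar>r\<bar> \<le> b}"
proof (rule finite_subset)
  let ?g = "\<lambda>(p :: int, q :: int). of_int p / of_int q :: real"
  let ?b = "\<lceil>b * of_int N\<rceil>"
  show "{r :: real. \<exists>p q :: int. 0 < q \<and> q \<le> N \<and> r = of_int p / of_int q \<and> \<bar>r\<bar> \<le> b}
      \<subseteq> ?g ` ({- ?b..?b} \<times> {0..N})"
  proof clarify
    fix p q :: int
    assume q: "0 < q" "q \<le> N" and b: "\<bar>real_of_int p / real_of_int q\<bar> \<le> b"
    then have "\<bar>real_of_int p\<bar> \<le> b * of_int q" by (simp add: abs_divide pos_divide_le_eq)
    also have "\<dots> \<le> b * of_int N" using q order_trans[OF abs_ge_zero b] by (intro mult_left_mono) auto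
    finally have "\<bar>p\<bar> \<le> ?b" by linarith
    then have "(p, q) \<in> {- ?b..?b} \<times> {0..N}" using q by auto
    then show "real_of_int p / real_of_int q \<in> ?g ` ({- ?b..?b} \<times> {0..N})" by force
  qed
qed auto

definition approximations :: "real \<Rightarrow> real \<Rightarrow> real set" where
  "approximations \<alpha> l = {r. \<exists>p q :: int. q > 0 \<and> r = of_int p / of_int q \<and>
     \<bar>\<alpha> - of_int p / of_int q\<bar> < 1 / (l * (of_int q)\<^sup>2)}"

text \<open>A supremum is insensitive to its boundary point, so the case \<open>l = K\<close> need
  not be decided.\<close>

lemma lagrange_number_eqI:
  assumes "\<And>l. 0 < l \<Longrightarrow> l < K \<Longrightarrow> infinite (approximations \<alpha> l)"
    and "\<And>l. K < l \<Longrightarrow> finite (approximations \<alpha> l)"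
    and "0 < K"
  shows "lagrange_number \<alpha> = ereal K"
  unfolding lagrange_number_def approximations_def[symmetric]
proof (rule antisym)
  show "Sup (ereal ` {l. infinite (approximations \<alpha> l)}) \<le> ereal K"
  proof (rule Sup_least, elim imageE CollectE)
    fix z l
    assume z: "z = ereal l" and inf: "infinite (approximations \<alpha> l)"
    have "\<not> K < l" using assms(2)[of l] inf by blast
    then show "z \<le> ereal K" unfolding z by simp
  qed
next
  show "ereal K \<le> Sup (ereal ` {l. infinite (approximations \<alpha> l)})" (is "_ \<le> ?S")
  proof (rule dense_le)
    fix z assume "z < ereal K"
    \<comment> \<open>Cutting off at 0 makes \<open>l\<close> positive, as the first hypothesis
      demands.\<close>
    then have "max z 0 < ereal K" using assms(3) by simp
    then obtain l where l: "max z 0 < ereal l" "ereal l < ereal K" using ereal_dense2 by blast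
    then have "ereal l \<le> ?S" using assms(1) by (intro Sup_upper) auto
    moreover have "z \<le> ereal l" using l(1) by (simp add: less_imp_le)
    ultimately show "z \<le> ?S" by (rule order_trans[rotated])
  qed
qed

text \<open>Dividing the factorization by the squared denominator gives \<open>dist\<close>: the
  error at p/q, times \<open>A * (p/q - \<beta>)\<close>, is the absolute value of
  \<open>F p q\<close> over the square of q. Near \<alpha> the second factor is close to
  \<open>A * (\<alpha> - \<beta>)\<close>. Hence the vectors \<open>(X n, Y n)\<close> supply
  infinitely many approximations for \<open>l\<close> below the claimed value, and the bound
  \<open>m\<close> leaves only finitely many above it.\<close>

lemma lagrange_number_quadratic:
  fixes A m :: int and \<alpha> \<beta> :: real and X Y :: "nat \<Rightarrow> int"
  assumes A: "0 < A" and \<alpha>: "0 < \<alpha>" and \<beta>: "\<beta> < 0"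
    and factor: "\<And>x y. of_int (F x y) = of_int A * (of_int x - \<alpha> * of_int y) * (of_int x - \<beta> * of_int y)"
    and m: "0 < m" "\<And>x y. 0 < x \<Longrightarrow> 0 < y \<Longrightarrow> m \<le> \<bar>F x y\<bar>"
    and XY: "\<And>n. 0 < X n" "\<And>n. int n < Y n" "\<And>n. \<bar>F (X n) (Y n)\<bar> = m"
  shows "lagrange_number \<alpha> = ereal (of_int A * (\<alpha> - \<beta>) / of_int m)"
proof -
  let ?K = "of_int A * (\<alpha> - \<beta>) / real_of_int m"
  have K: "0 < ?K" using assms by simp
  have dist: "\<bar>\<alpha> - of_int p / of_int q\<bar> * (of_int A * (of_int p / of_int q - \<beta>)) =
      of_int \<bar>F p q\<bar> / (of_int q)\<^sup>2" if "0 < q" "0 < p" for p q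
  proof -
    have eq: "real_of_int (F p q) = (of_int q)\<^sup>2 *
        (of_int A * (of_int p / of_int q - \<alpha>) * (of_int p / of_int q - \<beta>))"
      using that unfolding factor by (simp add: field_simps power2_eq_square)
    have "0 < real_of_int p / of_int q" using that by simp
    then have "0 < of_int p / of_int q - \<beta>" using \<beta> by linarith
    then have "\<bar>real_of_int (F p q)\<bar> = (of_int q)\<^sup>2 *
        (of_int A * \<bar>of_int p / of_int q - \<alpha>\<bar> * (of_int p / of_int q - \<beta>))"
      unfolding eq abs_mult using A by simp
    then show ?thesis using that by (simp add: field_simps abs_minus_commute)
  qed
  define r where "r n = real_of_int (X n) / of_int (Y n)" for n
  have Y0: "0 < Y n" for n using XY(2)[of n] by linarith
  have r0: "0 < r n" for n using XY(1) Y0 by (simp add: r_def)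
  have dist_r: "\<bar>\<alpha> - r n\<bar> * (of_int A * (r n - \<beta>)) = of_int m / (of_int (Y n))\<^sup>2" for n
    by (simp only: r_def dist[OF Y0 XY(1)] XY(3))
  have r_ne: "r n \<noteq> \<alpha>" for n using dist_r[of n] m(1) Y0[of n] by auto
  have r_lim: "r \<longlonglongrightarrow> \<alpha>"
  proof (rule LIM_zero_cancel, rule Lim_null_comparison)
    show "\<forall>\<^sub>F n in sequentially. norm (r n - \<alpha>) \<le> of_int m / (of_int A * - \<beta>) * inverse (real (Suc n))"
    proof (intro always_eventually allI)
      fix n
      \<comment> \<open>As \<open>r n\<close> is positive and \<beta> negative, the second factor in
        \<open>dist_r\<close> stays above a positive constant, so the error tends to 0 with the
        reciprocal of \<open>Y n\<close>.\<close>
      have "\<bar>\<alpha> - r n\<bar> * (of_int A * - \<beta>) \<le> \<bar>\<alpha> - r n\<bar> * (of_int A * (r n - \<beta>))"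
        using r0[of n] A by (intro mult_left_mono) auto
      also have "\<dots> = of_int m / (of_int (Y n))\<^sup>2" by (rule dist_r)
      also have "\<dots> \<le> of_int m / real (Suc n)"
      proof (rule divide_left_mono)
        have "real (Suc n) \<le> of_int (Y n)" using XY(2)[of n] by linarith
        also have "\<dots> \<le> (of_int (Y n))\<^sup>2" using Y0[of n] by (simp add: self_le_power)
        finally show "real (Suc n) \<le> (of_int (Y n))\<^sup>2" .
      qed (use m(1) Y0[of n] in auto)
      finally have "\<bar>\<alpha> - r n\<bar> * (of_int A * - \<beta>) \<le> of_int m / real (Suc n)" .
      moreover have "0 < of_int A * - \<beta>" using A \<beta> by (intro mult_pos_pos) auto
      ultimately have "\<bar>\<alpha> - r n\<bar> \<le> of_int m / real (Suc n) / (of_int A * - \<beta>)"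
        by (simp only: pos_le_divide_eq)
      then show "norm (r n - \<alpha>) \<le> of_int m / (of_int A * - \<beta>) * inverse (real (Suc n))"
        by (simp only: real_norm_def abs_minus_commute[of "r n"] divide_inverse mult_ac)
    qed
    show "(\<lambda>n. of_int m / (of_int A * - \<beta>) * inverse (real (Suc n))) \<longlonglongrightarrow> 0"
      using tendsto_mult_right_zero[OF LIMSEQ_inverse_real_of_nat] by blast
  qed
  have inf: "infinite (approximations \<alpha> l)" if l: "0 < l" "l < ?K" for l
  proof -
    let ?E = "approximations \<alpha> l"
    have "(\<lambda>n. of_int A * (r n - \<beta>)) \<longlonglongrightarrow> of_int A * (\<alpha> - \<beta>)"
      by (intro tendsto_intros r_lim)
    moreover have "l * of_int m < of_int A * (\<alpha> - \<beta>)" using l m(1) by (simp add: field_simps)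
    ultimately have ev: "\<forall>\<^sub>F n in sequentially. l * of_int m < of_int A * (r n - \<beta>)"
      by (rule order_tendstoD)
    have ev_E: "\<forall>\<^sub>F n in sequentially. r n \<in> ?E"
      using ev
    proof eventually_elim
      case (elim n)
      have "\<bar>\<alpha> - r n\<bar> * (l * of_int m) < \<bar>\<alpha> - r n\<bar> * (of_int A * (r n - \<beta>))"
        using elim r_ne[of n] by (intro mult_strict_left_mono) auto
      then have "\<bar>\<alpha> - r n\<bar> * l < 1 / (of_int (Y n))\<^sup>2"
        using m(1) Y0[of n] unfolding dist_r by (simp add: field_simps)
      then have "\<bar>\<alpha> - r n\<bar> < 1 / (l * (of_int (Y n))\<^sup>2)"
        using l(1) Y0[of n] by (simp add: field_simps)
      then show ?case using Y0[of n] unfolding r_def approximations_def by blast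
    qed
    show ?thesis
    proof
      assume fin: "finite ?E"
      \<comment> \<open>If only finitely many approximations existed, removing those different from
        \<alpha> would leave an open neighbourhood of \<alpha>. The sequence \<open>r\<close> would
        eventually stay in it, yet its terms are eventually approximations and never equal to
        \<alpha>.\<close>
      define S where "S = - (?E - {\<alpha>})"
      have "open S" unfolding S_def by (intro open_Compl finite_imp_closed finite_Diff fin)
      moreover have "\<alpha> \<in> S" unfolding S_def by blast
      ultimately have "\<forall>\<^sub>F n in sequentially. r n \<in> S"
        by (rule topological_tendstoD[OF r_lim])
      moreover have "r n \<notin> S" if "r n \<in> ?E" for n
        unfolding S_def using that r_ne[of n] by (simp only: Compl_iff Diff_iff singleton_iff) simp
      then have "\<forall>\<^sub>F n in sequentially. r n \<notin> S"
        using ev_E by (rule eventually_mono[rotated])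
      ultimately have "\<forall>\<^sub>F n in sequentially. False"
        by eventually_elim (rule notE)
      then show False by simp
    qed
  qed
  have fin: "finite (approximations \<alpha> l)" if l: "?K < l" for l
  proof -
    have l0: "0 < l" using l K by linarith
    \<comment> \<open>A lower bound for the distance of any approximation from \<alpha>. For
      \<open>p > 0\<close> the bound \<open>m\<close> forces \<open>A * (x - \<beta>)\<close> above
      \<open>m * l\<close>, which gives the second entry; for \<open>p \<le> 0\<close> the distance
      is at least \<alpha>. Since the distance is also below the reciprocal of l times the square of
      q, the denominator is bounded by \<open>N\<close>.\<close>
    define e where "e = min \<alpha> ((of_int m * l - of_int A * (\<alpha> - \<beta>)) / of_int A)"
    have e: "0 < e" using l \<alpha> A m(1) by (simp add: e_def field_simps)
    define N where "N = \<lceil>1 / (l * e)\<rceil>"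
    have "approximations \<alpha> l \<subseteq> {r. \<exists>p q :: int. 0 < q \<and> q \<le> N \<and> r = of_int p / of_int q \<and> \<bar>r\<bar> \<le> \<alpha> + 1 / l}"
      unfolding approximations_def
    proof clarify
      fix p q :: int
      assume q: "0 < q" and close: "\<bar>\<alpha> - of_int p / of_int q\<bar> < 1 / (l * (of_int q)\<^sup>2)"
      define x where "x = real_of_int p / of_int q"
      have q1: "1 \<le> real_of_int q" using q by simp
      have "e \<le> \<bar>\<alpha> - x\<bar>"
      proof (cases "0 < p")
        case True
        then have x: "0 < x" using q by (simp add: x_def)
        have "of_int m / (of_int q)\<^sup>2 \<le> of_int \<bar>F p q\<bar> / (real_of_int q)\<^sup>2"
          by (intro divide_right_mono) (use m(2)[OF True q] in auto)
        also have "\<dots> = \<bar>\<alpha> - x\<bar> * (of_int A * (x - \<beta>))"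
          unfolding x_def by (rule dist[OF q True, symmetric])
        also have "\<dots> < 1 / (l * (of_int q)\<^sup>2) * (of_int A * (x - \<beta>))"
          using close x \<beta> A by (intro mult_strict_right_mono) (auto simp: x_def)
        finally have "of_int m * l < of_int A * (x - \<beta>)"
          using q l0 by (simp add: field_simps)
        then have "(of_int m * l - of_int A * (\<alpha> - \<beta>)) / of_int A \<le> x - \<alpha>"
          using A by (simp add: field_simps)
        then show ?thesis unfolding e_def by linarith
      next
        case False
        then have "x \<le> 0" using q by (simp add: x_def divide_nonpos_pos)
        then show ?thesis unfolding e_def by linarith
      qed
      then have "e < 1 / (l * (of_int q)\<^sup>2)" using close by (simp add: x_def)
      then have "(of_int q)\<^sup>2 < 1 / (l * e)" using l0 e q by (simp add: field_simps)
      moreover have "of_int q \<le> (real_of_int q)\<^sup>2" using q1 by (simp add: self_le_power)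
      ultimately have "q \<le> N" unfolding N_def by linarith
      moreover have "1 / (l * (of_int q)\<^sup>2) \<le> 1 / l"
        using l0 q1 by (simp add: field_simps)
      then have "\<bar>x\<bar> \<le> \<alpha> + 1 / l" using close \<alpha> unfolding x_def by linarith
      ultimately show "\<exists>p' q' :: int. 0 < q' \<and> q' \<le> N \<and>
          real_of_int p / of_int q = of_int p' / of_int q' \<and> \<bar>real_of_int p / of_int q\<bar> \<le> \<alpha> + 1 / l"
        using q unfolding x_def by blast
    qed
    then show ?thesis by (rule finite_subset) (rule finite_rationals_bounded_denominator)
  qed
  show ?thesis by (rule lagrange_number_eqI[OF inf fin K])
qed

section \<open>Periodic continued fractions\<close>

lemma finite_cf_Cons: "as \<noteq> [] \<Longrightarrow> finite_cf (a # as) = real a + 1 / finite_cf as"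
  by (cases as) auto

lemma finite_cf_upt_Suc:
  "finite_cf (map a [k..<k + Suc (Suc n)]) = real (a k) + 1 / finite_cf (map a [Suc k..<Suc k + Suc n])"
proof -
  have "[k..<k + Suc (Suc n)] = k # [Suc k..<Suc k + Suc n]"
    by (subst upt_conv_Cons) auto
  then show ?thesis by (simp only: list.map) (subst finite_cf_Cons; simp)
qed

lemma finite_cf_ge_1:
  assumes "\<And>i. 1 \<le> a i"
  shows "1 \<le> finite_cf (map a [k..<k + Suc n])"
proof (induction n arbitrary: k)
  case 0
  then show ?case using assms[of k] by simp
next
  case (Suc n)
  show ?case
    using Suc[of "Suc k"] assms[of k] unfolding finite_cf_upt_Suc by (simp add: add_increasing2)
qed

text \<open>The \<xi> are the complete quotients. Passing from a tail to the preceding one divides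
  the error by \<open>F (Suc k) n * \<xi> (Suc k)\<close>. A single such factor is only known to be
  at least 1, but two successive ones multiply to at least 2, because
  \<open>\<xi> k * \<xi> (Suc k) = a k * \<xi> (Suc k) + 1\<close>.\<close>

lemma infinite_cf_eqI:
  fixes \<xi> :: "nat \<Rightarrow> real"
  assumes a: "\<And>i. 1 \<le> a i" and pos: "\<And>i. 0 < \<xi> i"
    and \<xi>: "\<And>i. \<xi> i = real (a i) + 1 / \<xi> (Suc i)"
  shows "infinite_cf a = \<xi> 0"
proof -
  have \<xi>1: "1 \<le> \<xi> i" for i
    using pos[of "Suc i"] a[of i] by (subst \<xi>) (simp add: add_increasing2)
  define F where "F k n = finite_cf (map a [k..<k + Suc n])" for k n
  have F1: "1 \<le> F k n" for k n unfolding F_def by (rule finite_cf_ge_1) (rule a)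
  have F0: "F k 0 = real (a k)" for k by (simp add: F_def)
  have FS: "F k (Suc n) = real (a k) + 1 / F (Suc k) n" for k n
    unfolding F_def by (rule finite_cf_upt_Suc)
  have diff: "\<bar>F k (Suc n) - \<xi> k\<bar> = \<bar>F (Suc k) n - \<xi> (Suc k)\<bar> / (F (Suc k) n * \<xi> (Suc k))" for k n
  proof -
    have "0 < F (Suc k) n" "0 < \<xi> (Suc k)" using F1[of "Suc k" n] pos by auto
    moreover have "F k (Suc n) - \<xi> k = 1 / F (Suc k) n - 1 / \<xi> (Suc k)"
      by (simp add: FS \<xi>[of k])
    moreover have "\<dots> = (\<xi> (Suc k) - F (Suc k) n) / (F (Suc k) n * \<xi> (Suc k))"
      using calculation by (simp add: field_simps)
    ultimately show ?thesis by (simp add: abs_divide abs_mult abs_minus_commute)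
  qed
  have \<xi>2: "2 \<le> \<xi> k * \<xi> (Suc k)" for k
  proof -
    have "\<xi> k * \<xi> (Suc k) = real (a k) * \<xi> (Suc k) + 1"
      using pos[of "Suc k"] by (subst \<xi>) (simp add: field_simps)
    moreover have "1 * 1 \<le> real (a k) * \<xi> (Suc k)"
      using a[of k] \<xi>1 by (intro mult_mono) auto
    ultimately show ?thesis by simp
  qed
  \<comment> \<open>Halving over two steps is a factor \<open>sqrt (1 / 2)\<close> per step; the
    leading 2 makes the base case \<open>n = 1\<close> true, where the error is only known to be at
    most 1.\<close>
  have bound: "\<bar>F k n - \<xi> k\<bar> \<le> 2 * sqrt (1 / 2) ^ n" for k n
  proof (induction n arbitrary: k rule: induct_nat_012)
    case 0
    have "\<bar>F k 0 - \<xi> k\<bar> = 1 / \<xi> (Suc k)" using pos[of "Suc k"] by (simp add: F0 \<xi>[of k])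
    also have "\<dots> \<le> 1" using \<xi>1[of "Suc k"] by simp
    finally show ?case by simp
  next
    case 1
    have "\<bar>F (Suc k) 0 - \<xi> (Suc k)\<bar> = 1 / \<xi> (Suc (Suc k))"
      using pos[of "Suc (Suc k)"] by (simp add: F0 \<xi>[of "Suc k"])
    also have "\<dots> \<le> 1" using \<xi>1[of "Suc (Suc k)"] by simp
    finally have "\<bar>F (Suc k) 0 - \<xi> (Suc k)\<bar> \<le> 1" .
    moreover have "1 * 1 \<le> F (Suc k) 0 * \<xi> (Suc k)"
      using F1 \<xi>1 by (intro mult_mono) (auto intro: order_trans[OF zero_le_one])
    ultimately have "\<bar>F k (Suc 0) - \<xi> k\<bar> \<le> 1 / 1"
      unfolding diff by (intro frac_le) auto
    moreover have "1 \<le> 2 * sqrt (1 / 2)"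
      using real_le_rsqrt[of "1 / 2" "1 / 2"] by (simp add: power2_eq_square)
    ultimately show ?case by simp
  next
    case (ge2 n)
    let ?p = "F (Suc k) (Suc n) * \<xi> (Suc k)" and ?q = "F (Suc (Suc k)) n * \<xi> (Suc (Suc k))"
    have "1 * 2 \<le> (F (Suc k) (Suc n) * F (Suc (Suc k)) n) * (\<xi> (Suc k) * \<xi> (Suc (Suc k)))"
    proof (intro mult_mono)
      have "1 * 1 \<le> F (Suc k) (Suc n) * F (Suc (Suc k)) n"
        using F1 by (intro mult_mono) (auto intro: order_trans[OF zero_le_one])
      then show "1 \<le> F (Suc k) (Suc n) * F (Suc (Suc k)) n"
        "0 \<le> F (Suc k) (Suc n) * F (Suc (Suc k)) n" by auto
    qed (use \<xi>2 in auto)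
    then have "2 \<le> ?p * ?q" by (simp add: mult_ac)
    then have "\<bar>F k (Suc (Suc n)) - \<xi> k\<bar> \<le> 2 * sqrt (1 / 2) ^ n / 2"
      unfolding diff using ge2(1)[of "Suc (Suc k)"]
      by (simp only: divide_divide_eq_left mult.commute[of ?q ?p]) (intro frac_le; auto)
    also have "\<dots> = 2 * (sqrt (1 / 2) ^ n * (sqrt (1 / 2))\<^sup>2)"
      by (subst real_sqrt_pow2) auto
    also have "\<dots> = 2 * sqrt (1 / 2) ^ Suc (Suc n)"
      by (simp only: power_Suc power2_eq_square mult_ac)
    finally show ?case .
  qed
  have "(\<lambda>n. F 0 n - \<xi> 0) \<longlonglongrightarrow> 0"
  proof (rule Lim_null_comparison)
    show "\<forall>\<^sub>F n in sequentially. norm (F 0 n - \<xi> 0) \<le> 2 * sqrt (1 / 2) ^ n"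
      using bound[of 0] by simp
    have "sqrt (1 / 2) < 1" by (simp add: real_sqrt_lt_1_iff)
    then show "(\<lambda>n. 2 * sqrt (1 / 2) ^ n) \<longlonglongrightarrow> 0"
      by (intro tendsto_mult_right_zero LIMSEQ_power_zero) simp
  qed
  then have "F 0 \<longlonglongrightarrow> \<xi> 0" by (simp add: LIM_zero_iff)
  then show ?thesis unfolding infinite_cf_def F_def by (simp add: limI)
qed

definition cf_append :: "nat list \<Rightarrow> real \<Rightarrow> real" where
  "cf_append as x = foldr (\<lambda>a x. real a + 1 / x) as x"

lemma cf_append_pos: "0 < x \<Longrightarrow> 0 < cf_append as x"
  by (induction as) (auto simp: cf_append_def add_nonneg_pos)

text \<open>The complete quotient at position \<open>i\<close> is the rest of the current period
  followed by \<open>x\<close>; at the end of a period the fixed-point equation closes the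
  recursion.\<close>

lemma periodic_cf_eqI:
  assumes c: "c \<noteq> []" "0 \<notin> set c" and x: "0 < x" "cf_append c x = x"
  shows "periodic_cf c = x"
proof -
  define \<xi> where "\<xi> i = cf_append (drop (i mod length c) c) x" for i
  have "infinite_cf (\<lambda>i. c ! (i mod length c)) = \<xi> 0"
  proof (rule infinite_cf_eqI)
    fix i
    let ?j = "i mod length c"
    have j: "?j < length c" using c by simp
    then have "c ! ?j \<in> set c" by simp
    then show "1 \<le> c ! ?j" using c(2) by (metis less_one not_le)
    show "0 < \<xi> i" unfolding \<xi>_def by (rule cf_append_pos[OF x(1)])
    have "\<xi> i = real (c ! ?j) + 1 / cf_append (drop (Suc ?j) c) x"
      unfolding \<xi>_def using Cons_nth_drop_Suc[OF j, symmetric] by (simp add: cf_append_def)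
    moreover have "cf_append (drop (Suc ?j) c) x = \<xi> (Suc i)"
    proof (cases "Suc ?j = length c")
      case True
      then have "Suc i mod length c = 0" by (simp add: mod_Suc)
      then show ?thesis using True x(2) by (simp add: \<xi>_def cf_append_def)
    qed (simp add: \<xi>_def mod_Suc)
    ultimately show "\<xi> i = real (c ! ?j) + 1 / \<xi> (Suc i)" by simp
  qed
  then show ?thesis by (simp add: periodic_cf_def \<xi>_def x(2))
qed

text \<open>The tuple lists the rows of the matrix product of the factors \<open>((a, 1), (1, 0))\<close>.\<close>
fun cf_matrix :: "nat list \<Rightarrow> int \<times> int \<times> int \<times> int" where
  "cf_matrix [] = (1, 0, 0, 1)"
| "cf_matrix (a # as) =
     (case cf_matrix as of (p, q, r, s) \<Rightarrow> (int a * p + r, int a * q + s, p, q))"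

text \<open>Positivity is carried through the same induction, since each numerator becomes the next
  denominator.\<close>

lemma cf_append_eq_moebius:
  assumes "cf_matrix as = (p, q, r, s)" "0 < x"
  shows "0 < of_int p * x + of_int q" "0 < of_int r * x + of_int s"
    "cf_append as x = (of_int p * x + of_int q) / (of_int r * x + of_int s)"
proof -
  have "0 < of_int p * x + of_int q \<and> 0 < of_int r * x + of_int s \<and>
      cf_append as x = (of_int p * x + of_int q) / (of_int r * x + of_int s)"
    using assms(1)
  proof (induction as arbitrary: p q r s)
    case Nil
    then show ?case using assms(2) by (auto simp: cf_append_def)
  next
    case (Cons a as)
    obtain p' q' r' s' where M: "cf_matrix as = (p', q', r', s')" by (cases "cf_matrix as")
    then have eq: "p = int a * p' + r'" "q = int a * q' + s'" "r = p'" "s = q'"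
      using Cons.prems by auto
    let ?u = "of_int p' * x + of_int q'" and ?v = "of_int r' * x + of_int s'"
    have IH: "0 < ?u" "0 < ?v" "cf_append as x = ?u / ?v" using Cons.IH[OF M] by auto
    have num: "of_int p * x + of_int q = real a * ?u + ?v"
      by (simp add: eq algebra_simps)
    have "cf_append (a # as) x = real a + 1 / cf_append as x" by (simp add: cf_append_def)
    also have "1 / cf_append as x = ?v / ?u" unfolding IH(3) by simp
    also have "real a + ?v / ?u = (real a * ?u + ?v) / ?u"
      using IH(1) by (simp add: add_divide_distrib del: of_int_add of_int_mult)
    finally show ?case
      using IH(1,2) unfolding num eq(3,4) by (simp add: add_nonneg_pos)
  qed
  then show "0 < of_int p * x + of_int q" "0 < of_int r * x + of_int s"
    "cf_append as x = (of_int p * x + of_int q) / (of_int r * x + of_int s)" by auto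
qed

lemma periodic_cf_fixed_point:
  assumes "c \<noteq> []" "0 \<notin> set c" "cf_matrix c = (p, q, r, s)" "0 < x"
    and "of_int r * x\<^sup>2 + of_int (s - p) * x - of_int q = 0"
  shows "periodic_cf c = x"
proof (rule periodic_cf_eqI[OF assms(1,2,4)])
  have "of_int p * x + of_int q = x * (of_int r * x + of_int s)"
    using assms(5) by (simp add: algebra_simps power2_eq_square)
  then show "cf_append c x = x"
    using cf_append_eq_moebius(2,3)[OF assms(3,4)] by simp
qed

text \<open>The form is the determinant of the vector \<open>(x, y)\<close> and its image under the
  matrix. Applying the matrix to both multiplies it by \<open>p * s - q * r\<close>.\<close>

lemma form_automorphism:
  assumes "p * s - q * r = 1"
  shows "form (r, s - p, q) (p * x + q * y) (r * x + s * y) = form (r, s - p, q) x y"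
proof -
  have "form (r, s - p, q) (p * x + q * y) (r * x + s * y) =
      (p * s - q * r) * form (r, s - p, q) x y"
    by (simp add: power2_eq_square) algebra
  then show ?thesis using assms by simp
qed

lemma quadratic_factor:
  fixes a b c d :: real
  assumes "d\<^sup>2 = b\<^sup>2 + 4 * a * c" "a \<noteq> 0"
  shows "a * t\<^sup>2 + b * t * u - c * u\<^sup>2 =
    a * (t - (- b + d) / (2 * a) * u) * (t - (- b - d) / (2 * a) * u)"
proof -
  define \<alpha> \<beta> where "\<alpha> = (- b + d) / (2 * a)" and "\<beta> = (- b - d) / (2 * a)"
  have "2 * a * \<alpha> = - b + d" "2 * a * \<beta> = - b - d"
    using assms(2) by (simp_all add: \<alpha>_def \<beta>_def)
  then have "4 * a * (a * t\<^sup>2 + b * t * u - c * u\<^sup>2) = 4 * a * (a * (t - \<alpha> * u) * (t - \<beta> * u))"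
    using assms(1) by algebra
  then show ?thesis using assms(2) by (simp add: \<alpha>_def \<beta>_def)
qed

text \<open>The result depends on the word only through the trace \<open>p + s\<close> and the
  minimum \<open>m\<close>, so it can agree for words that are not cyclically equivalent.
  Determinant 1 reflects an even period.\<close>

lemma lagrange_number_periodic_cf:
  assumes c: "c \<noteq> []" "0 \<notin> set c" and M: "cf_matrix c = (p, q, r, s)" "p * s - q * r = 1"
    and pos: "0 < p" "0 < q" "0 < r" "0 < s"
    and m: "0 < m" "\<And>n. outer_ge m ((river_step ^^ n) (r, s - p, q))"
    and v: "0 < x" "0 < y" "\<bar>form (r, s - p, q) x y\<bar> = m"
  shows "lagrange_number (periodic_cf c) = ereal (sqrt (of_int ((p + s)\<^sup>2 - 4)) / of_int m)"
proof -
  define d where "d = sqrt (of_int ((s - p)\<^sup>2 + 4 * r * q))"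
  define \<alpha> \<beta> where "\<alpha> = (- of_int (s - p) + d) / (2 * of_int r)"
    and "\<beta> = (- of_int (s - p) - d) / (2 * of_int r)"
  have d2: "d\<^sup>2 = (of_int (s - p))\<^sup>2 + 4 * of_int r * of_int q"
    using pos by (simp add: d_def)
  have fac: "of_int r * t\<^sup>2 + of_int (s - p) * t * u - of_int q * u\<^sup>2 =
      of_int r * (t - \<alpha> * u) * (t - \<beta> * u)" for t u
    unfolding \<alpha>_def \<beta>_def by (rule quadratic_factor[OF d2]) (use pos in simp)
  have factor: "real_of_int (form (r, s - p, q) x y) =
      of_int r * (of_int x - \<alpha> * of_int y) * (of_int x - \<beta> * of_int y)" for x y
    using fac[of "of_int x" "of_int y"] by simp
  \<comment> \<open>As \<open>r * q\<close> is positive, the root of the discriminant exceeds the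
    middle coefficient in absolute value, so the two roots have opposite signs.\<close>
  have "\<bar>real_of_int (s - p)\<bar> = sqrt (of_int ((s - p)\<^sup>2))" by simp
  also have "\<dots> < d" unfolding d_def using pos by (intro real_sqrt_less_mono) simp
  finally have "\<bar>real_of_int (s - p)\<bar> < d" .
  then have \<alpha>: "0 < \<alpha>" and \<beta>: "\<beta> < 0"
    using pos by (auto simp: \<alpha>_def \<beta>_def field_simps)
  have cf: "periodic_cf c = \<alpha>"
    by (rule periodic_cf_fixed_point[OF c M(1) \<alpha>]) (use fac[of \<alpha> 1] in simp)
  \<comment> \<open>The orbit of the minimal vector under the period matrix: the value of the form
    is preserved, and the second coordinate grows by at least 1 each time because \<open>r\<close>
    and \<open>s\<close> are positive.\<close>
  define V where "V n = ((\<lambda>(x, y). (p * x + q * y, r * x + s * y)) ^^ n) (x, y)" for n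
  have V_Suc: "V (Suc n) = (p * fst (V n) + q * snd (V n), r * fst (V n) + s * snd (V n))" for n
    by (simp add: V_def case_prod_beta)
  have V: "0 < fst (V n) \<and> int n < snd (V n) \<and> \<bar>form (r, s - p, q) (fst (V n)) (snd (V n))\<bar> = m" for n
  proof (induction n)
    case 0
    then show ?case using v by (simp add: V_def)
  next
    case (Suc n)
    then have IH: "0 < fst (V n)" "int n < snd (V n)" by auto
    have "0 < p * fst (V n)" "0 \<le> q * snd (V n)" "0 < r * fst (V n)" using IH pos by auto
    moreover have "1 * snd (V n) \<le> s * snd (V n)"
      using IH pos by (intro mult_right_mono) auto
    ultimately have "0 < p * fst (V n) + q * snd (V n)" "int (Suc n) < r * fst (V n) + s * snd (V n)"
      using IH(2) by linarith+
    then show ?case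
      using Suc form_automorphism[OF M(2), of "fst (V n)" "snd (V n)"]
      unfolding V_Suc fst_conv snd_conv by (auto simp del: form.simps)
  qed
  have "lagrange_number \<alpha> = ereal (of_int r * (\<alpha> - \<beta>) / of_int m)"
    by (rule lagrange_number_quadratic[OF pos(3) \<alpha> \<beta> factor m(1),
          where X = "\<lambda>n. fst (V n)" and Y = "\<lambda>n. snd (V n)"])
      (use V abs_form_ge[OF m(2,1)] in \<open>auto simp del: form.simps\<close>)
  also have "of_int r * (\<alpha> - \<beta>) = d"
    using pos by (simp add: \<alpha>_def \<beta>_def field_simps)
  also have "(s - p)\<^sup>2 + 4 * r * q = (p + s)\<^sup>2 - 4 * (p * s - q * r)"
    by (simp add: power2_eq_square algebra_simps)
  then have "d = sqrt (of_int ((p + s)\<^sup>2 - 4))" by (simp add: d_def M(2))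
  finally show ?thesis by (simp only: cf)
qed

section \<open>The two paths\<close>

lemma coeff_word_\<omega>\<^sub>1: "coeff_word \<omega>\<^sub>1 =
  [2,1,1,2,2,1,1,2,2,1,1,1,1,1,1,1,1,1,1,2,2,2,2,2,1,1,2,1,1,2,2,1,1,1,1,2,1,1]"
  by code_simp

lemma coeff_word_\<omega>\<^sub>2: "coeff_word \<omega>\<^sub>2 =
  [2,1,1,2,2,1,1,1,1,2,2,1,1,1,1,1,1,1,1,2,2,2,1,1,2,2,2,1,1,2,2,1,1,1,1,2,1,1]"
  by code_simp

lemma cf_matrix_\<omega>\<^sub>1:
  "cf_matrix (coeff_word \<omega>\<^sub>1) = (16314172772, 9467087387, 6307169825, 3660040183)"
  unfolding coeff_word_\<omega>\<^sub>1 by simp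

lemma cf_matrix_\<omega>\<^sub>2:
  "cf_matrix (coeff_word \<omega>\<^sub>2) = (16314310154, 9467165801, 6306933953, 3659902801)"
  unfolding coeff_word_\<omega>\<^sub>2 by simp

text \<open>Each vector at which the minimum 6252914545 is attained consists of the numerator and
  denominator of the convergent that uses the first 35 partial quotients.\<close>

lemma path_lagrange_\<omega>\<^sub>1:
  "path_lagrange \<omega>\<^sub>1 = ereal (sqrt (19974212955\<^sup>2 - 4) / 6252914545)"
proof -
  let ?s = "(6307169825, 3660040183 - 16314172772, 9467087387) :: int \<times> int \<times> int"
  \<comment> \<open>The river period 52 is the sum of the partial quotients in the coefficient word:
    a partial quotient k accounts for k consecutive steps of one kind. The same count serves for the
    second path.\<close>
  have "iterates_all (outer_ge 6252914545) river_step 52 ?s ?s"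
    by (simp add: eval_nat_numeral)
  then have "outer_ge 6252914545 ((river_step ^^ n) ?s)" for n
    by (rule iterates_all_cycle[of _ _ 52]) simp
  from lagrange_number_periodic_cf[OF _ _ cf_matrix_\<omega>\<^sub>1 _ _ _ _ _ _ this,
      where x = 2620002002 and y = 1012910541]
  show ?thesis by (simp add: path_lagrange_def coeff_word_\<omega>\<^sub>1)
qed

lemma path_lagrange_\<omega>\<^sub>2:
  "path_lagrange \<omega>\<^sub>2 = ereal (sqrt (19974212955\<^sup>2 - 4) / 6252914545)"
proof -
  let ?s = "(6306933953, 3659902801 - 16314310154, 9467165801) :: int \<times> int \<times> int"
  have "iterates_all (outer_ge 6252914545) river_step 52 ?s ?s"
    by (simp add: eval_nat_numeral)
  then have "outer_ge 6252914545 ((river_step ^^ n) ?s)" for n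
    by (rule iterates_all_cycle[of _ _ 52]) simp
  from lagrange_number_periodic_cf[OF _ _ cf_matrix_\<omega>\<^sub>2 _ _ _ _ _ _ this,
      where x = 2620021448 and y = 1012871649]
  show ?thesis by (simp add: path_lagrange_def coeff_word_\<omega>\<^sub>2)
qed

text \<open>Carrying the current lattice point lets simplification check the path in one pass
  instead of recounting every prefix.\<close>

fun stays_below :: "nat \<Rightarrow> nat \<Rightarrow> nat \<Rightarrow> nat \<Rightarrow> step list \<Rightarrow> bool" where
  "stays_below a b x y [] \<longleftrightarrow> a * y \<le> b * x"
| "stays_below a b x y (R # w) \<longleftrightarrow> a * y \<le> b * x \<and> stays_below a b (Suc x) y w"
| "stays_below a b x y (U # w) \<longleftrightarrow> a * y \<le> b * x \<and> stays_below a b x (Suc y) w"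

lemma stays_below_iff:
  "stays_below a b x y w \<longleftrightarrow>
    (\<forall>k\<le>length w. a * (y + count_list (take k w) U) \<le> b * (x + count_list (take k w) R))"
  by (induction a b x y w rule: stays_below.induct)
    (simp_all add: less_Suc_eq_le[symmetric] All_less_Suc2 del: mult_Suc_right)

lemma lattice_paths_\<omega>:
  "\<omega>\<^sub>1 \<in> lattice_paths 17 9" "\<omega>\<^sub>2 \<in> lattice_paths 17 9"
proof -
  have "stays_below 17 9 0 0 \<omega>\<^sub>1" "stays_below 17 9 0 0 \<omega>\<^sub>2"
    by (simp_all add: \<omega>\<^sub>1_def \<omega>\<^sub>2_def)
  then have "\<forall>k\<le>length w. 17 * count_list (take k w) U \<le> 9 * count_list (take k w) R"
    if "w \<in> {\<omega>\<^sub>1, \<omega>\<^sub>2}" for w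
    using that unfolding stays_below_iff by auto
  then show "\<omega>\<^sub>1 \<in> lattice_paths 17 9" "\<omega>\<^sub>2 \<in> lattice_paths 17 9"
    unfolding lattice_paths_def by (simp_all add: \<omega>\<^sub>1_def \<omega>\<^sub>2_def)
qed

text \<open>Turns the bounded search over rotations into a finite disjunction that simplification
  decides by repeated single shifts.\<close>

fun is_rotation :: "nat \<Rightarrow> 'a list \<Rightarrow> 'a list \<Rightarrow> bool" where
  "is_rotation 0 c d \<longleftrightarrow> False"
| "is_rotation (Suc n) c d \<longleftrightarrow> d = c \<or> is_rotation n (rotate1 c) d"

lemma is_rotation_iff: "is_rotation n c d \<longleftrightarrow> (\<exists>k<n. d = rotate k c)"
  by (induction n arbitrary: c) (auto simp: Ex_less_Suc2 rotate1_rotate_swap)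

lemma cyc_equiv_iff_is_rotation:
  "cyc_equiv c d \<longleftrightarrow> length c = length d \<and>
    (is_rotation (length c) c d \<or> is_rotation (length c) (rev c) d)"
  unfolding cyc_equiv_def is_rotation_iff by blast

lemma not_cyc_equiv_coeff_words: "\<not> cyc_equiv (coeff_word \<omega>\<^sub>1) (coeff_word \<omega>\<^sub>2)"
  unfolding coeff_word_\<omega>\<^sub>1 coeff_word_\<omega>\<^sub>2 cyc_equiv_iff_is_rotation by simp

theorem theorem1:
  shows "\<omega>\<^sub>1 \<in> lattice_paths 17 9 \<and> \<omega>\<^sub>2 \<in> lattice_paths 17 9 \<and>
         path_lagrange \<omega>\<^sub>1 = path_lagrange \<omega>\<^sub>2 \<and>
         \<not> path_band_graph \<omega>\<^sub>1 \<cong>\<^sub>B path_band_graph \<omega>\<^sub>2 \<and>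
         \<not> (\<forall>a b. 0 < b \<and> b < a \<and> coprime a b \<longrightarrow>
              (\<forall>\<omega> \<in> lattice_paths a b. \<forall>\<upsilon> \<in> lattice_paths a b.
                 path_lagrange \<omega> = path_lagrange \<upsilon> \<longrightarrow> path_band_graph \<omega> \<cong>\<^sub>B path_band_graph \<upsilon>))"
proof -
  have L: "path_lagrange \<omega>\<^sub>1 = path_lagrange \<omega>\<^sub>2"
    by (simp only: path_lagrange_\<omega>\<^sub>1 path_lagrange_\<omega>\<^sub>2)
  have G: "\<not> path_band_graph \<omega>\<^sub>1 \<cong>\<^sub>B path_band_graph \<omega>\<^sub>2"
    using path_band_graph_iso_iff[OF lattice_paths_\<omega>] not_cyc_equiv_coeff_words by simp
  have "coprime 17 (9 :: nat)" by (simp add: coprime_iff_gcd_eq_1 gcd_non_0_nat)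
  moreover have "(0 :: nat) < 9" "9 < (17 :: nat)" by simp_all
  ultimately show ?thesis using L G lattice_paths_\<omega> by blast
qed

end
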